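(* Let $f:\mathbb{Z}_N\to\mathbb{C}$ be nonzero and let $\eta>0$. Then for any integer $k$ such that $$k>8\left(\frac{\|\widehat f\|_{L^1(\mu)}}{\|f\|_\infty}\right)^2\frac{N\log(4N)}{\eta^2},$$ there exists a trigonometric polynomial $$P(x)=\sum_{i=1}^k c_i\,\chi(m_i x)\qquad(c_i\in\mathbb{C},\ m_i\in\mathbb{Z}_N)$$ such that $$\|f-P\|_\infty<\eta\,\|f\|_\infty .$$
   Context: $N$ is a positive integer, $\mathbb{Z}_N=\mathbb{Z}/N\mathbb{Z}$, $\chi(t)=e^{2\pi i t/N}$. For $f:\mathbb{Z}_N\to\mathbb{C}$ the unitary Fourier transform is $\widehat f(m)=N^{-1/2}\sum_{x\in\mathbb{Z}_N}\chi(-xm)f(x)$. $\|g\|_{L^1(\mu)}=\frac1N\sum_{x\in\mathbb{Z}_N}|g(x)|$ and $\|g\|_\infty=\max_{x\in\mathbb{Z}_N}|g(x)|$. $\log$ is the natural logarithm. *)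

theory Defs
  imports "HOL-Analysis.Analysis" "HOL-Number_Theory.Cong"
begin

(* The residue classes modulo N are represented by the integers 0, ..., N - 1.  A complex function
   on the integers modulo N is a function g :: int => complex of which only the values on
   Zmod N are used. *)
definition Zmod :: "nat \<Rightarrow> int set" where
  "Zmod N = {0..<int N}"

(* Defined on all integers; it depends only on the residue class (lemma chi_cong), so products and
   negatives of residues can be formed in the integers without reducing modulo N. *)
definition chi :: "nat \<Rightarrow> int \<Rightarrow> complex" where
  "chi N t = exp (2 * complex_of_real pi * \<i> * of_int t / of_nat N)"

definition fourier :: "nat \<Rightarrow> (int \<Rightarrow> complex) \<Rightarrow> int \<Rightarrow> complex" where
  "fourier N f m = complex_of_real (real N powr (-1/2)) * (\<Sum>x\<in>Zmod N. chi N (- (x * m)) * f x)"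

definition L1_norm :: "nat \<Rightarrow> (int \<Rightarrow> complex) \<Rightarrow> real" where
  "L1_norm N g = (1 / real N) * (\<Sum>x\<in>Zmod N. norm (g x))"

definition sup_norm :: "nat \<Rightarrow> (int \<Rightarrow> complex) \<Rightarrow> real" where
  "sup_norm N g = Max ((\<lambda>x. norm (g x)) ` Zmod N)"

definition trig_poly :: "nat \<Rightarrow> int \<Rightarrow> (int \<Rightarrow> complex) \<Rightarrow> (int \<Rightarrow> int) \<Rightarrow> int \<Rightarrow> complex" where
  "trig_poly N k c m x = (\<Sum>i=1..k. c i * chi N (m i * x))"

lemma chi_cong:
  assumes "N > 0" and "[s = t] (mod int N)"
  shows "chi N s = chi N t"
proof -
  obtain q where q: "s = t + int N * q"
    using cong_sym[OF assms(2)] unfolding cong_iff_lin by blast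
  have "2 * complex_of_real pi * \<i> * of_int s / of_nat N =
        2 * complex_of_real pi * \<i> * of_int t / of_nat N + 2 * of_int q * complex_of_real pi * \<i>"
    using assms(1) by (simp add: q field_simps)
  moreover have "exp ((2 * of_int q * complex_of_real pi) * \<i>) = 1"
    using exp_integer_2pi[of "of_int q"] by (simp add: mult_ac)
  ultimately show ?thesis
    unfolding chi_def by (simp add: exp_add)
qed

end

theory Submission
  imports Defs "HOL-Probability.Hoeffding" "HOL-Probability.Product_PMF"
begin

text \<open>
  By Fourier inversion, \<open>f\<close> is the expectation of the random function
  \<open>Z\<^sub>m(x) = A sgn(f^(m)) \<chi>(m x)\<close> with \<open>A = (\<Sum>m. |f^(m)|) / sqrt N\<close>, when the frequency \<open>m\<close> is
  drawn with probability proportional to \<open>|f^(m)|\<close>. Hoeffding's inequality for the real and the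
  imaginary part, together with a union bound over the \<open>N\<close> points, shows that with positive
  probability the average of \<open>k\<close> independent copies is uniformly close to \<open>f\<close>.
\<close>

section \<open>Sampling\<close>

text \<open>Hoeffding's inequality for independent draws from \<open>p\<close>: under
  \<open>Pi_pmf\<close> the values \<open>g (\<omega> i)\<close> are independent, share the mean of
  \<open>g\<close> under \<open>p\<close>, and lie almost surely in an interval of length
  \<open>2 * A\<close>. The squared lengths add up to \<open>4 * card I * A\<^sup>2\<close>.\<close>

lemma prob_Pi_pmf_deviation_le:
  fixes g :: "'a \<Rightarrow> real" and p :: "'a pmf" and A \<epsilon> :: real
  assumes I: "finite I" "I \<noteq> {}" and A: "A > 0" and eps: "\<epsilon> \<ge> 0"
    and g: "\<And>a. a \<in> set_pmf p \<Longrightarrow> \<bar>g a\<bar> \<le> A"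
  shows "measure_pmf.prob (Pi_pmf I d (\<lambda>_. p))
           {\<omega>. \<epsilon> \<le> \<bar>(\<Sum>i\<in>I. g (\<omega> i)) - card I * measure_pmf.expectation p g\<bar>}
         \<le> 2 * exp (- \<epsilon>\<^sup>2 / (2 * real (card I) * A\<^sup>2))"
proof -
  let ?M = "Pi_pmf I d (\<lambda>_. p)"
  have E: "measure_pmf.expectation ?M (\<lambda>\<omega>. g (\<omega> i)) = measure_pmf.expectation p g" if "i \<in> I" for i
  proof -
    have "measure_pmf.expectation ?M (\<lambda>\<omega>. g (\<omega> i)) =
          measure_pmf.expectation (map_pmf (\<lambda>\<omega>. \<omega> i) ?M) g"
      by simp
    then show ?thesis
      using that I by (simp only: Pi_pmf_component if_True)
  qed
  interpret H: Hoeffding_ineq "measure_pmf ?M" I "\<lambda>i \<omega>. g (\<omega> i)" "\<lambda>_. - A" "\<lambda>_. A"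
    "card I * measure_pmf.expectation p g"
  proof unfold_locales
    show "finite I" by fact
    show "prob_space.indep_vars (measure_pmf ?M) (\<lambda>_. borel) (\<lambda>i \<omega>. g (\<omega> i)) I"
      using prob_space.indep_vars_compose2[OF measure_pmf.prob_space_axioms
          indep_vars_Pi_pmf[OF I(1), of d "\<lambda>_. p"],
          of "\<lambda>_. g" "\<lambda>_. borel"] by simp
    show "AE \<omega> in measure_pmf ?M. g (\<omega> i) \<in> {- A..A}" if "i \<in> I" for i
    proof (rule AE_pmfI)
      fix \<omega> assume "\<omega> \<in> set_pmf ?M"
      then have "\<omega> i \<in> set_pmf p"
        using I(1) that by (auto simp: set_Pi_pmf PiE_dflt_def)
      from g[OF this] show "g (\<omega> i) \<in> {- A..A}" by auto
    qed
    show "card I * measure_pmf.expectation p g \<equiv>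
          \<Sum>i\<in>I. measure_pmf.expectation ?M (\<lambda>\<omega>. g (\<omega> i))"
      using E by (intro eq_reflection) simp
  qed
  have "(\<Sum>i\<in>I. (A - - A)\<^sup>2) = 4 * real (card I) * A\<^sup>2"
    by (simp add: power2_eq_square)
  moreover have "4 * real (card I) * A\<^sup>2 > 0"
    using I A by (simp add: card_gt_0_iff)
  moreover have "-2 * \<epsilon>\<^sup>2 / (4 * real (card I) * A\<^sup>2) = - \<epsilon>\<^sup>2 / (2 * real (card I) * A\<^sup>2)"
    by (simp add: field_simps)
  ultimately show ?thesis
    using H.Hoeffding_ineq_abs_ge[OF eps] by (simp add: mult.assoc)
qed

text \<open>Were both parts smaller than \<open>s / sqrt 2\<close> in absolute value, their squares
  would add up to less than \<open>s\<^sup>2\<close>. This reduces a complex deviation to two real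
  ones.\<close>

lemma cmod_ge_imp_Re_or_Im_ge:
  assumes "s \<le> cmod z"
  shows "s / sqrt 2 \<le> \<bar>Re z\<bar> \<or> s / sqrt 2 \<le> \<bar>Im z\<bar>"
  using assms real_sqrt_sum_squares_less[of "Re z" s "Im z"] by (force simp: cmod_def)

text \<open>Union bound: each point of \<open>X\<close> has a real and an imaginary deviation, each
  with a two-sided tail, so a sample fails with probability at most \<open>4 * card X\<close> times
  one Hoeffding exponential. Hypothesis \<open>k\<close> makes this less than 1.\<close>

lemma exists_uniform_sample:
  fixes Z :: "'a \<Rightarrow> 'b \<Rightarrow> complex" and p :: "'a pmf" and A t :: real
  assumes p: "finite (set_pmf p)" and X: "finite X" "X \<noteq> {}" and I: "finite I" "I \<noteq> {}"
    and A: "A > 0" and t: "t > 0"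
    and Z: "\<And>a x. a \<in> set_pmf p \<Longrightarrow> x \<in> X \<Longrightarrow> cmod (Z a x) \<le> A"
    and k: "4 * A\<^sup>2 * ln (4 * real (card X)) < card I * t\<^sup>2"
  shows "\<exists>\<omega>. (\<forall>i\<in>I. \<omega> i \<in> set_pmf p) \<and>
           (\<forall>x\<in>X. cmod ((\<Sum>i\<in>I. Z (\<omega> i) x) - card I * measure_pmf.expectation p (\<lambda>a. Z a x))
                    < card I * t)"
proof (rule ccontr)
  assume no_sample: "\<not> ?thesis"
  let ?M = "Pi_pmf I undefined (\<lambda>_. p)"
  \<comment> \<open>The factor \<open>1 / sqrt 2\<close>, squared, turns the 2 in the denominator of
    the Hoeffding exponent into the 4 of hypothesis \<open>k\<close>.\<close>
  define \<epsilon> where "\<epsilon> = card I * t / sqrt 2"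
  define q where "q = 2 * exp (- \<epsilon>\<^sup>2 / (2 * real (card I) * A\<^sup>2))"
  define D where "D = (\<lambda>g. {\<omega>. \<epsilon> \<le> \<bar>(\<Sum>i\<in>I. g (\<omega> i)) - card I * measure_pmf.expectation p g\<bar>})"
  define B where "B = (\<lambda>x. D (\<lambda>a. Re (Z a x)) \<union> D (\<lambda>a. Im (Z a x)))"
  have card_pos: "card I > 0" "card X > 0"
    using X I by (simp_all add: card_gt_0_iff)
  have "\<epsilon> \<ge> 0"
    using t by (simp add: \<epsilon>_def)
  have D: "measure_pmf.prob ?M (D g) \<le> q" if "\<And>a. a \<in> set_pmf p \<Longrightarrow> \<bar>g a\<bar> \<le> A" for g
    unfolding D_def q_def by (rule prob_Pi_pmf_deviation_le) (use I A \<open>\<epsilon> \<ge> 0\<close> that in auto)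
  have B: "measure_pmf.prob ?M (B x) \<le> 2 * q" if "x \<in> X" for x
  proof -
    have "\<bar>Re (Z a x)\<bar> \<le> A" "\<bar>Im (Z a x)\<bar> \<le> A" if "a \<in> set_pmf p" for a
      using Z[OF that \<open>x \<in> X\<close>] abs_Re_le_cmod[of "Z a x"] abs_Im_le_cmod[of "Z a x"] by linarith+
    then have "measure_pmf.prob ?M (D (\<lambda>a. Re (Z a x))) \<le> q"
      "measure_pmf.prob ?M (D (\<lambda>a. Im (Z a x))) \<le> q"
      by (auto intro!: D)
    moreover have "measure_pmf.prob ?M (B x) \<le>
        measure_pmf.prob ?M (D (\<lambda>a. Re (Z a x))) + measure_pmf.prob ?M (D (\<lambda>a. Im (Z a x)))"
      unfolding B_def by (rule measure_Un_le) auto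
    ultimately show ?thesis by simp
  qed
  \<comment> \<open>Integrability lets \<open>Re\<close> and \<open>Im\<close> pass through the
    expectation.\<close>
  have int: "integrable (measure_pmf p) (\<lambda>a. Z a x)" for x
    by (rule integrable_measure_pmf_finite[OF p])
  \<comment> \<open>If no sample is good, every outcome in the support is bad at some point, so the
    union of the bad events has probability 1.\<close>
  have "\<omega> \<in> (\<Union>x\<in>X. B x)" if "\<omega> \<in> set_pmf ?M" for \<omega>
  proof -
    have "\<forall>i\<in>I. \<omega> i \<in> set_pmf p"
      using that I by (auto simp: set_Pi_pmf PiE_dflt_def)
    then obtain x where x: "x \<in> X" and
      "card I * t \<le> cmod ((\<Sum>i\<in>I. Z (\<omega> i) x) - card I * measure_pmf.expectation p (\<lambda>a. Z a x))"
      using no_sample by (meson not_less)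
    from cmod_ge_imp_Re_or_Im_ge[OF this(2)] have "\<omega> \<in> B x"
      by (simp add: B_def D_def \<epsilon>_def integral_Re[OF int] integral_Im[OF int])
    with x show ?thesis by blast
  qed
  then have "1 = measure_pmf.prob ?M (\<Union>x\<in>X. B x)"
    by (subst eq_commute, subst measure_pmf.prob_eq_1) (auto intro: AE_pmfI)
  also have "\<dots> \<le> (\<Sum>x\<in>X. measure_pmf.prob ?M (B x))"
    by (rule measure_UNION_le) (use X in auto)
  also have "\<dots> \<le> (\<Sum>x\<in>X. 2 * q)"
    by (rule sum_mono) (use B in auto)
  also have "\<dots> = 4 * real (card X) * exp (- (real (card I) * t\<^sup>2 / (4 * A\<^sup>2)))"
    using card_pos A by (simp add: q_def \<epsilon>_def power2_eq_square field_simps)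
  also have "\<dots> < 4 * real (card X) * exp (- ln (4 * real (card X)))"
    using k A card_pos by (simp add: field_simps)
  also have "\<dots> = 1"
    using card_pos by (simp add: exp_minus)
  finally show False by simp
qed

section \<open>Fourier inversion on the integers modulo N\<close>

lemma finite_Zmod [simp]: "finite (Zmod N)"
  by (simp add: Zmod_def)

lemma card_Zmod [simp]: "card (Zmod N) = N"
  by (simp add: Zmod_def)

lemma chi_add: "chi N (s + t) = chi N s * chi N t"
  by (simp add: chi_def exp_add[symmetric] add_divide_distrib ring_distribs)

lemma norm_chi [simp]: "cmod (chi N t) = 1"
proof -
  have "chi N t = cis (2 * pi * of_int t / of_nat N)"
    by (simp add: chi_def cis_conv_exp field_simps)
  then show ?thesis by simp
qed

lemma chi_of_nat_mult: "chi N (int n * t) = chi N t ^ n"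
  by (simp add: chi_def exp_of_nat_mult[symmetric] field_simps)

lemma chi_eq_1_iff:
  assumes "N > 0"
  shows "chi N t = 1 \<longleftrightarrow> int N dvd t"
proof
  assume "int N dvd t"
  then have "chi N t = chi N 0"
    using assms by (intro chi_cong) (auto simp: cong_0_iff)
  then show "chi N t = 1" by (simp add: chi_def)
next
  assume "chi N t = 1"
  then obtain n :: int where "2 * pi * real_of_int t / real N = of_int (2 * n) * pi"
    unfolding chi_def exp_eq_1 by auto
  then have "real_of_int t = real_of_int (int N * n)"
    using assms by (simp add: field_simps)
  then have "t = int N * n"
    by (simp only: of_int_eq_iff)
  then show "int N dvd t" by simp
qed

text \<open>Orthogonality of characters: a geometric sum whose ratio \<open>chi N t\<close> is an
  \<open>N\<close>-th root of unity, equal to 1 exactly when \<open>N\<close> divides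
  \<open>t\<close>.\<close>

lemma sum_chi:
  assumes "N > 0"
  shows "(\<Sum>m\<in>Zmod N. chi N (m * t)) = (if int N dvd t then of_nat N else 0)"
proof -
  have "(\<Sum>m\<in>Zmod N. chi N (m * t)) = (\<Sum>n<N. chi N (int n * t))"
    unfolding Zmod_def by (rule sum.reindex_bij_witness[of _ int nat]) auto
  also have "\<dots> = (\<Sum>n<N. chi N t ^ n)"
    by (simp add: chi_of_nat_mult)
  also have "\<dots> = (if int N dvd t then of_nat N else 0)"
  proof (cases "int N dvd t")
    case True
    then have "chi N t = 1"
      using chi_eq_1_iff[OF assms] by simp
    with True show ?thesis by simp
  next
    case False
    then have "chi N t \<noteq> 1" "chi N t ^ N = 1"
      using chi_eq_1_iff[OF assms] by (simp_all flip: chi_of_nat_mult)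
    with False show ?thesis by (simp add: geometric_sum)
  qed
  finally show ?thesis .
qed

text \<open>After exchanging the sums, orthogonality leaves only the term \<open>y = x\<close>. The
  point \<open>x\<close> must lie in \<open>Zmod N\<close>: the right-hand side is periodic, while
  \<open>f\<close> is arbitrary on other integers.\<close>

lemma fourier_inversion:
  assumes "N > 0" "x \<in> Zmod N"
  shows "f x = of_real (real N powr (-1/2)) * (\<Sum>m\<in>Zmod N. fourier N f m * chi N (m * x))"
proof -
  let ?r = "complex_of_real (real N powr (-1/2))"
  \<comment> \<open>The two unitary normalisations together cancel the factor \<open>N\<close> of
    the character sum.\<close>
  have rr: "?r * ?r = 1 / of_nat N"
    using assms by (simp add: powr_minus divide_simps flip: of_real_mult powr_add)
  have dvd_iff: "int N dvd x - y \<longleftrightarrow> y = x" if "y \<in> Zmod N" for y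
    using that assms by (auto simp: Zmod_def simp flip: mod_eq_dvd_iff)
  have "(\<Sum>m\<in>Zmod N. fourier N f m * chi N (m * x)) =
        (\<Sum>m\<in>Zmod N. \<Sum>y\<in>Zmod N. ?r * f y * chi N (m * (x - y)))"
  proof (rule sum.cong[OF refl])
    fix m
    have "chi N (m * (x - y)) = chi N (- (y * m)) * chi N (m * x)" for y
      by (simp add: algebra_simps flip: chi_add)
    then show "fourier N f m * chi N (m * x) = (\<Sum>y\<in>Zmod N. ?r * f y * chi N (m * (x - y)))"
      by (simp add: fourier_def sum_distrib_left sum_distrib_right mult_ac)
  qed
  also have "\<dots> = (\<Sum>y\<in>Zmod N. ?r * f y * (\<Sum>m\<in>Zmod N. chi N (m * (x - y))))"
    by (subst sum.swap) (simp add: sum_distrib_left)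
  also have "\<dots> = (\<Sum>y\<in>Zmod N. if y = x then ?r * f y * of_nat N else 0)"
    by (rule sum.cong) (simp_all add: sum_chi[OF assms(1)] dvd_iff)
  also have "\<dots> = ?r * f x * of_nat N"
    using assms by (simp add: sum.delta')
  finally show ?thesis
    using rr assms by (simp flip: mult.assoc)
qed

section \<open>Approximation by short trigonometric polynomials\<close>

text \<open>Provides the law of the random frequency; the weights are extended by zero outside
  \<open>S\<close>.\<close>

lemma exists_pmf_weights:
  fixes w :: "'a \<Rightarrow> real"
  assumes "finite S" "\<And>a. a \<in> S \<Longrightarrow> w a \<ge> 0" "(\<Sum>a\<in>S. w a) = 1"
  shows "\<exists>p. set_pmf p \<subseteq> S \<and> (\<forall>a\<in>S. pmf p a = w a)"
proof -
  let ?w = "\<lambda>a. if a \<in> S then w a else 0"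
  have "(\<integral>\<^sup>+a. ennreal (?w a) \<partial>count_space UNIV) = (\<Sum>a\<in>S. ennreal (?w a))"
    by (rule nn_integral_count_space'[OF assms(1)]) auto
  also have "\<dots> = 1"
    using assms by (simp add: sum_ennreal)
  finally have w: "(\<integral>\<^sup>+a. ennreal (?w a) \<partial>count_space UNIV) = 1" .
  have nonneg: "?w a \<ge> 0" for a
    using assms by simp
  show ?thesis
    using pmf_embed_pmf[of ?w, OF nonneg w] set_embed_pmf[of ?w, OF nonneg w]
    by (intro exI[of _ "embed_pmf ?w"]) (auto split: if_splits)
qed

text \<open>Drawing \<open>m\<close> with probability proportional to
  \<open>cmod (fourier N f m)\<close> gives all samples of positive probability the same modulus
  \<open>A\<close>, which serves as the bound in the sampling lemma.\<close>

lemma exists_trig_poly_approximation: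
  fixes N :: nat and f :: "int \<Rightarrow> complex" and k :: int and t :: real
  defines "A \<equiv> real N powr (-1/2) * (\<Sum>m\<in>Zmod N. cmod (fourier N f m))"
  assumes N: "N > 0" and A: "A > 0" and t: "t > 0" and k0: "k > 0"
    and k: "4 * A\<^sup>2 * ln (4 * real N) < k * t\<^sup>2"
  shows "\<exists>(c :: int \<Rightarrow> complex) (m :: int \<Rightarrow> int).
           (\<forall>i\<in>{1..k}. m i \<in> Zmod N) \<and> (\<forall>x\<in>Zmod N. cmod (f x - trig_poly N k c m x) < t)"
proof -
  define S where "S = (\<Sum>m\<in>Zmod N. cmod (fourier N f m))"
  have AS: "A = real N powr (-1/2) * S"
    by (simp add: A_def S_def)
  with A have S: "S > 0"
    by (simp add: zero_less_mult_iff)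
  obtain p where p: "set_pmf p \<subseteq> Zmod N" "\<And>m. m \<in> Zmod N \<Longrightarrow> pmf p m = cmod (fourier N f m) / S"
    using exists_pmf_weights[of "Zmod N" "\<lambda>m. cmod (fourier N f m) / S"] S
    by (auto simp: S_def simp flip: sum_divide_distrib)
  \<comment> \<open>The probability of \<open>m\<close> times \<open>A * sgn (fourier N f m)\<close>
    equals \<open>N powr (-1/2) * fourier N f m\<close>, so the mean of \<open>Z\<close> is the
    inversion formula.\<close>
  define Z where "Z = (\<lambda>m x. of_real A * sgn (fourier N f m) * chi N (m * x))"
  have E: "measure_pmf.expectation p (\<lambda>m. Z m x) = f x" if "x \<in> Zmod N" for x
  proof -
    have "measure_pmf.expectation p (\<lambda>m. Z m x) = (\<Sum>m\<in>Zmod N. pmf p m *\<^sub>R Z m x)"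
      by (rule integral_measure_pmf) (use p in auto)
    also have "\<dots> = (\<Sum>m\<in>Zmod N. of_real (real N powr (-1/2)) * (fourier N f m * chi N (m * x)))"
    proof (rule sum.cong[OF refl])
      fix m assume "m \<in> Zmod N"
      have "complex_of_real (cmod z) * sgn z = z" for z
        by (simp add: sgn_eq)
      then show "pmf p m *\<^sub>R Z m x =
          of_real (real N powr (-1/2)) * (fourier N f m * chi N (m * x))"
        using S by (simp add: p(2)[OF \<open>m \<in> Zmod N\<close>] Z_def AS scaleR_conv_of_real mult_ac)
    qed
    also have "\<dots> = f x"
      using fourier_inversion[OF N that, of f] by (simp add: sum_distrib_left)
    finally show ?thesis .
  qed
  have "\<exists>m. (\<forall>i\<in>{1..k}. m i \<in> set_pmf p) \<and>
          (\<forall>x\<in>Zmod N. cmod ((\<Sum>i\<in>{1..k}. Z (m i) x) -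
             card {1..k} * measure_pmf.expectation p (\<lambda>a. Z a x)) < card {1..k} * t)"
  proof (rule exists_uniform_sample[of p "Zmod N" "{1..k}" A t Z])
    show "finite (set_pmf p)"
      using p(1) by (rule finite_subset) simp
    show "Zmod N \<noteq> {}"
      using N by (simp add: Zmod_def)
    show "cmod (Z a x) \<le> A" for a x
      using A by (simp add: Z_def norm_mult norm_sgn)
  qed (use A t k k0 in auto)
  then obtain m where m: "\<forall>i\<in>{1..k}. m i \<in> set_pmf p"
    "\<forall>x\<in>Zmod N. cmod ((\<Sum>i\<in>{1..k}. Z (m i) x) - of_int k * f x) < k * t"
    using k0 by (auto simp: E simp del: atLeastAtMost_iff)
  \<comment> \<open>Division by \<open>k\<close> turns the sum of the samples into their mean;
    frequencies may repeat.\<close>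
  define c where "c = (\<lambda>i. of_real A * sgn (fourier N f (m i)) / of_int k)"
  have "cmod (f x - trig_poly N k c m x) < t" if "x \<in> Zmod N" for x
  proof -
    have "(\<Sum>i\<in>{1..k}. Z (m i) x) = of_int k * trig_poly N k c m x"
      using k0 by (simp add: trig_poly_def Z_def c_def sum_distrib_left)
    then have "(\<Sum>i\<in>{1..k}. Z (m i) x) - of_int k * f x =
        of_int k * (trig_poly N k c m x - f x)"
      by (simp add: algebra_simps)
    with bspec[OF m(2) that] k0 have "k * cmod (trig_poly N k c m x - f x) < k * t"
      by (simp add: norm_mult)
    with k0 show ?thesis
      by (simp add: norm_minus_commute)
  qed
  with m(1) p(1) show ?thesis by blast
qed

lemma sup_norm_less_iff:
  assumes "N > 0"
  shows "sup_norm N g < t \<longleftrightarrow> (\<forall>x\<in>Zmod N. cmod (g x) < t)"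
  unfolding sup_norm_def using assms by (subst Max_less_iff) (auto simp: Zmod_def)

lemma norm_le_sup_norm: "x \<in> Zmod N \<Longrightarrow> cmod (g x) \<le> sup_norm N g"
  unfolding sup_norm_def by (intro Max_ge) auto

theorem theorem1p12:
  fixes N :: nat and f :: "int \<Rightarrow> complex" and \<eta> :: real and k :: int
  assumes "N > 0"
    and "\<exists>x\<in>Zmod N. f x \<noteq> 0"
    and "\<eta> > 0"
    and "real_of_int k >
           8 * (L1_norm N (fourier N f) / sup_norm N f)\<^sup>2 * (real N * ln (4 * real N) / \<eta>\<^sup>2)"
  shows "\<exists>(c :: int \<Rightarrow> complex) (m :: int \<Rightarrow> int).
           (\<forall>i\<in>{1..k}. m i \<in> Zmod N) \<and>
           sup_norm N (\<lambda>x. f x - trig_poly N k c m x) < \<eta> * sup_norm N f"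
proof -
  define S where "S = (\<Sum>m\<in>Zmod N. cmod (fourier N f m))"
  define M where "M = sup_norm N f"
  define A where "A = real N powr (-1/2) * S"
  obtain x where x: "x \<in> Zmod N" "f x \<noteq> 0"
    using assms(2) by blast
  have M: "M > 0"
    using norm_le_sup_norm[OF x(1), of f] x(2) by (simp add: M_def less_le_trans[of 0 "cmod (f x)"])
  \<comment> \<open>By inversion, a nonzero \<open>f\<close> has a nonzero Fourier
    coefficient.\<close>
  have "S \<noteq> 0"
  proof
    assume "S = 0"
    then have "\<forall>m\<in>Zmod N. fourier N f m = 0"
      by (simp add: S_def sum_nonneg_eq_0_iff)
    then show False
      using fourier_inversion[OF assms(1) x(1), of f] x(2) by simp
  qed
  then have S: "S > 0"
    by (simp add: S_def sum_nonneg less_le)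
  have A: "A > 0"
    using S assms(1) by (simp add: A_def)
  have ln: "ln (4 * real N) > 0"
    using assms(1) by simp
  \<comment> \<open>Both \<open>A\<^sup>2\<close> and \<open>N\<close> times the squared
    \<open>L1_norm\<close> of the transform equal \<open>S\<^sup>2 / N\<close>, which rewrites the
    bound on \<open>k\<close> in terms of \<open>A\<close>.\<close>
  have "(real N powr (-1/2))\<^sup>2 = 1 / real N"
    using assms(1) by (simp add: power2_eq_square powr_minus divide_simps flip: powr_add)
  then have "A\<^sup>2 = S\<^sup>2 / real N"
    by (simp add: A_def power_mult_distrib)
  moreover have "L1_norm N (fourier N f) = S / real N"
    by (simp add: L1_norm_def S_def)
  ultimately have "8 * (L1_norm N (fourier N f) / sup_norm N f)\<^sup>2 * (real N * ln (4 * real N) / \<eta>\<^sup>2) =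
      8 * A\<^sup>2 * ln (4 * real N) / (\<eta> * M)\<^sup>2"
    using assms(1) by (simp add: M_def power_divide power_mult_distrib power2_eq_square[of "real N"]
        mult_ac)
  with assms(4) have k: "8 * A\<^sup>2 * ln (4 * real N) / (\<eta> * M)\<^sup>2 < k"
    by simp
  have t: "\<eta> * M > 0"
    using M assms(3) by simp
  \<comment> \<open>The lower bound on \<open>k\<close> is positive, so the index set
    \<open>{1..k}\<close> is nonempty.\<close>
  have "0 < 8 * A\<^sup>2 * ln (4 * real N) / (\<eta> * M)\<^sup>2"
    using A ln M assms(3) by (intro divide_pos_pos mult_pos_pos zero_less_power) auto
  with k have k0: "k > 0" by linarith
  have "4 * A\<^sup>2 * ln (4 * real N) \<le> 8 * A\<^sup>2 * ln (4 * real N)"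
    using ln by simp
  also have "\<dots> < k * (\<eta> * M)\<^sup>2"
    using k zero_less_power[OF t, of 2] by (simp only: pos_divide_less_eq)
  finally have "4 * A\<^sup>2 * ln (4 * real N) < k * (\<eta> * M)\<^sup>2" .
  then show ?thesis
    using exists_trig_poly_approximation[of N f "\<eta> * M" k] assms(1) A t k0
    by (simp add: sup_norm_less_iff A_def S_def M_def)
qed

end
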